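(* Let $q<0$ and consider $$c:=\inf_{u\in H^1(\mathbb{R})}E(u,0),\qquad d:=\inf\{E(u,0):u\in H^1_{\sin}(\mathbb{R}),\ u(-\infty)=0,\ u(\infty)=2\pi\}.$$ If $-2\le q<0$, the infimum $c$ is reached by $u=0$, while if $q<-2$ then $0>c=E(Q,0)$. Similarly, for any $q<0$, the infimum $d$ is reached by the kink: $d=E(K,0)$.
   Context: All functions are real valued. $H^1_{\sin}(\mathbb{R})=\{u\in\dot H^1(\mathbb{R}):\sin(u/2)\in L^2(\mathbb{R})\}$; $u(\pm\infty)$ denotes $\lim_{x\to\pm\infty}u(x)$. The energy is $$E(u_1,u_2)=\int_{\mathbb{R}}\tfrac12|u_2|^2+\tfrac12|\partial_xu_1|^2+(1-\cos u_1)\,dx+q\,(1-\cos u_1(0)).$$ $K(x)=4\arctan e^x$ and, for $|q|>2$, $Q(x)=4\arctan\left(\sqrt{\frac{q+2}{q-2}}\,e^{-|x|}\right)$. *)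

theory Defs
  imports "HOL-Analysis.Analysis"
begin

definition test_function :: "(real \<Rightarrow> real) \<Rightarrow> bool" where
  "test_function \<phi> \<longleftrightarrow>
     (\<forall>n x. (deriv ^^ n) \<phi> field_differentiable at x) \<and> compact (closure {x. \<phi> x \<noteq> 0})"

definition locally_integrable :: "(real \<Rightarrow> real) \<Rightarrow> bool" where
  "locally_integrable f \<longleftrightarrow> (\<forall>a b. set_integrable lborel {a..b} f)"

definition L2 :: "(real \<Rightarrow> real) set" where
  "L2 = {f \<in> borel_measurable lborel. integrable lborel (\<lambda>x. (f x)\<^sup>2)}"

definition has_weak_deriv :: "(real \<Rightarrow> real) \<Rightarrow> (real \<Rightarrow> real) \<Rightarrow> bool" where
  "has_weak_deriv u g \<longleftrightarrow> locally_integrable u \<and> locally_integrable g \<and>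
     (\<forall>\<phi>. test_function \<phi> \<longrightarrow>
        (LINT x|lborel. u x * deriv \<phi> x) = - (LINT x|lborel. g x * \<phi> x))"

text \<open>The weak derivative is unique up to null sets; a representative is chosen.\<close>

definition weak_deriv :: "(real \<Rightarrow> real) \<Rightarrow> real \<Rightarrow> real" where
  "weak_deriv u = (SOME g. has_weak_deriv u g)"

text \<open>
  Every locally integrable function on the line with weak derivative in \<open>L2\<close> agrees almost
  everywhere with exactly one continuous function. The elements of the spaces below are these
  continuous representatives, which gives \<open>u 0\<close> and the limits at infinity their usual meaning.
  The homogeneous space is not divided by the constants.
\<close>

definition H1_dot :: "(real \<Rightarrow> real) set" where
  "H1_dot = {u. continuous_on UNIV u \<and> (\<exists>g\<in>L2. has_weak_deriv u g)}"

definition H1 :: "(real \<Rightarrow> real) set" where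
  "H1 = {u \<in> H1_dot. u \<in> L2}"

definition H1_sin :: "(real \<Rightarrow> real) set" where
  "H1_sin = {u \<in> H1_dot. (\<lambda>x. sin (u x / 2)) \<in> L2}"

definition energy :: "real \<Rightarrow> (real \<Rightarrow> real) \<Rightarrow> (real \<Rightarrow> real) \<Rightarrow> real" where
  "energy q u1 u2 =
     (LINT x|lborel. 1/2 * \<bar>u2 x\<bar>\<^sup>2 + 1/2 * \<bar>weak_deriv u1 x\<bar>\<^sup>2 + (1 - cos (u1 x)))
     + q * (1 - cos (u1 0))"

definition kink :: "real \<Rightarrow> real" where
  "kink x = 4 * arctan (exp x)"

text \<open>Only meaningful for \<open>\<bar>q\<bar> > 2\<close>.\<close>

definition pinned_state :: "real \<Rightarrow> real \<Rightarrow> real" where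
  "pinned_state q x = 4 * arctan (sqrt ((q + 2) / (q - 2)) * exp (- \<bar>x\<bar>))"

end

theory Submission
  imports Defs "HOL-Real_Asymp.Real_Asymp"
begin

text \<open>
  Along a continuous \<open>u\<close> with weak derivative \<open>g\<close>, completing the square
  (\<open>g\<^sup>2 / 2 + 1 - cos u \<ge> \<plusminus> 2 sin (u / 2) g\<close>, the Bogomolny trick) shows that the energy of an interval is
  at least the variation of \<open>\<mp> 4 cos (u / 2)\<close> over it. For \<open>u\<close> vanishing at both ends the two half
  lines together give \<open>8 (1 - z)\<close> with \<open>z = cos (u 0 / 2)\<close>, while the defect contributes
  \<open>2 q (1 - z\<^sup>2)\<close>; minimising over \<open>z \<in> [-1, 1]\<close> gives \<open>0\<close> at \<open>z = 1\<close> if \<open>q \<ge> - 2\<close>, and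
  \<open>2 (q + 2)\<^sup>2 / q\<close> at \<open>z = - 2 / q\<close> otherwise. For kinks the bound is \<open>8 + 2 q\<close>. The profiles
  \<open>4 arctan (k exp (\<plusminus> x))\<close> solve the first order equation, so they attain these bounds.

  Since the weak derivative is only characterised by its action on test functions, one needs the
  fundamental theorem \<open>u b - u a = \<integral> g\<close>. It comes from testing with smooth approximations of the
  indicator function of \<open>[a, b]\<close>, built from \<open>exp (- 1 / x)\<close>.
\<close>

subsection \<open>Smooth steps\<close>

text \<open>Peeling the first derivative off the inside suits induction on the order with arbitrary
  functions, which is how all closure properties below are proved.\<close>

primrec kdiff :: "nat \<Rightarrow> (real \<Rightarrow> real) \<Rightarrow> bool" where
  "kdiff 0 f = True"
| "kdiff (Suc n) f = ((\<forall>x. f field_differentiable at x) \<and> kdiff n (deriv f))"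

lemma kdiff_iff: "kdiff n f \<longleftrightarrow> (\<forall>m<n. \<forall>x. (deriv ^^ m) f field_differentiable at x)"
proof (induction n arbitrary: f)
  case (Suc n)
  show ?case
    unfolding kdiff.simps Suc.IH All_less_Suc2
    by (simp add: funpow_swap1)
qed simp

lemma kdiff_Suc_D: "kdiff (Suc n) f \<Longrightarrow> kdiff n f"
  by (simp add: kdiff_iff)

lemma kdiff_SucI:
  assumes "\<And>x. (f has_field_derivative f' x) (at x)" "kdiff n f'"
  shows "kdiff (Suc n) f"
proof -
  have "deriv f = f'" using assms(1) by (auto intro: DERIV_imp_deriv)
  then show ?thesis using assms by (auto simp: field_differentiable_def)
qed

lemma kdiff_Suc_E:
  assumes "kdiff (Suc n) f"
  obtains f' where "\<And>x. (f has_field_derivative f' x) (at x)" "kdiff n f'" "kdiff n f"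
  using assms kdiff_Suc_D[OF assms] 
  by (metis DERIV_deriv_iff_field_differentiable kdiff.simps(2))

lemma kdiff_add: "kdiff n f \<Longrightarrow> kdiff n g \<Longrightarrow> kdiff n (\<lambda>x. f x + g x)"
proof (induction n arbitrary: f g)
  case (Suc n)
  obtain f' where f: "\<And>x. (f has_field_derivative f' x) (at x)" "kdiff n f'" "kdiff n f"
    using Suc.prems(1) by (rule kdiff_Suc_E) blast
  obtain g' where g: "\<And>x. (g has_field_derivative g' x) (at x)" "kdiff n g'" "kdiff n g"
    using Suc.prems(2) by (rule kdiff_Suc_E) blast
  show ?case
    by (rule kdiff_SucI[where f' = "\<lambda>x. f' x + g' x"]) (auto intro!: Suc.IH f g derivative_eq_intros)
qed simp

text \<open>The product rule leaves one factor undifferentiated in each summand, so the induction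
  also uses that \<open>f\<close> and \<open>g\<close> themselves have order
  \<open>n\<close>.\<close>

lemma kdiff_mult: "kdiff n f \<Longrightarrow> kdiff n g \<Longrightarrow> kdiff n (\<lambda>x. f x * g x)"
proof (induction n arbitrary: f g)
  case (Suc n)
  obtain f' where f: "\<And>x. (f has_field_derivative f' x) (at x)" "kdiff n f'" "kdiff n f"
    using Suc.prems(1) by (rule kdiff_Suc_E) blast
  obtain g' where g: "\<And>x. (g has_field_derivative g' x) (at x)" "kdiff n g'" "kdiff n g"
    using Suc.prems(2) by (rule kdiff_Suc_E) blast
  show ?case
    by (rule kdiff_SucI[where f' = "\<lambda>x. f' x * g x + f x * g' x"])
      (auto intro!: kdiff_add Suc.IH f g DERIV_mult' simp: add.commute[of "f' _ * _"])
qed simp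

lemma kdiff_const: "kdiff n (\<lambda>x. c)"
proof (induction n arbitrary: c)
  case (Suc n)
  show ?case by (rule kdiff_SucI[where f' = "\<lambda>x. 0"]) (auto intro: Suc.IH)
qed simp

lemma kdiff_cmult: "kdiff n f \<Longrightarrow> kdiff n (\<lambda>x. c * f x)"
  by (intro kdiff_mult kdiff_const)

lemma kdiff_diff: "kdiff n f \<Longrightarrow> kdiff n g \<Longrightarrow> kdiff n (\<lambda>x. f x - g x)"
  using kdiff_add[of n f "\<lambda>x. (-1) * g x"] kdiff_cmult[of n g "-1"] by simp

lemma kdiff_affine: "kdiff n f \<Longrightarrow> kdiff n (\<lambda>x. f (c * x + d))"
proof (induction n arbitrary: f)
  case (Suc n)
  obtain f' where f: "\<And>x. (f has_field_derivative f' x) (at x)" "kdiff n f'" "kdiff n f"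
    using Suc.prems(1) by (rule kdiff_Suc_E) blast
  show ?case
  proof (rule kdiff_SucI[where f' = "\<lambda>x. c * f' (c * x + d)"])
    show "((\<lambda>x. f (c * x + d)) has_field_derivative c * f' (c * x + d)) (at x)" for x
    proof -
      have "((\<lambda>x. c * x + d) has_field_derivative c) (at x)"
        by (auto intro!: derivative_eq_intros)
      from DERIV_chain2[OF f(1) this] show ?thesis by (simp add: mult.commute)
    qed
  qed (intro kdiff_cmult Suc.IH f)
qed simp

text \<open>The derivative is written as \<open>f'\<close> times two copies of
  \<open>inverse (f x)\<close>, to which the induction hypothesis applies again.\<close>

lemma kdiff_inverse: "kdiff n f \<Longrightarrow> (\<And>x. f x \<noteq> 0) \<Longrightarrow> kdiff n (\<lambda>x. inverse (f x))"
proof (induction n)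
  case (Suc n)
  obtain f' where f: "\<And>x. (f has_field_derivative f' x) (at x)" "kdiff n f'" "kdiff n f"
    using Suc.prems(1) by (rule kdiff_Suc_E) blast
  show ?case
  proof (rule kdiff_SucI[where f' = "\<lambda>x. (-1) * (f' x * (inverse (f x) * inverse (f x)))"])
    show "((\<lambda>x. inverse (f x)) has_field_derivative (-1) * (f' x * (inverse (f x) * inverse (f x)))) (at x)" for x
      using DERIV_inverse_fun[OF f(1) Suc.prems(2), of x] by (simp add: mult_ac)
  qed (intro kdiff_cmult kdiff_mult Suc.IH f Suc.prems)
qed simp

section \<open>A flat function and the smooth step\<close>

lemma poly_times_exp_minus_tendsto_0: "((\<lambda>t::real. poly p t * exp (- t)) \<longlongrightarrow> 0) at_top"
proof -
  have "((\<lambda>t. \<Sum>i\<le>degree p. coeff p i * (t ^ i / exp t)) \<longlongrightarrow> (\<Sum>i\<le>degree p. coeff p i * 0)) at_top"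
    by (intro tendsto_intros tendsto_power_div_exp_0)
  then show ?thesis
    by (simp add: poly_altdef sum_distrib_right exp_minus divide_inverse mult.assoc)
qed

text \<open>The functions \<open>p (1/x) exp (- 1/x)\<close>, extended by \<open>0\<close> to the negative half line, are closed
  under differentiation.\<close>

lemma kdiff_flat: "kdiff n (\<lambda>x. if x > 0 then poly p (1 / x) * exp (- (1 / x)) else 0)"
proof (induction n arbitrary: p)
  case (Suc n)
  let ?f = "\<lambda>p x. if x > (0::real) then poly p (1 / x) * exp (- (1 / x)) else 0"
  \<comment> \<open>With \<open>s = 1 / x\<close>, the derivative of \<open>p(s) exp(-s)\<close> in
    \<open>x\<close> is \<open>s^2 (p(s) - p'(s)) exp(-s)\<close>, because \<open>s\<close> has
    derivative \<open>-s^2\<close>.\<close>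
  let ?p' = "[:0, 0, 1:] * (p - pderiv p)"
  have "(?f p has_field_derivative ?f ?p' x) (at x)" for x
  proof -
    consider "x > 0" | "x < 0" | "x = 0" by linarith
    then show ?thesis
    proof cases
      case 1
      have "((\<lambda>x. poly p (1 / x) * exp (- (1 / x))) has_field_derivative ?f ?p' x) (at x)"
        using 1 by (auto intro!: derivative_eq_intros DERIV_chain2[OF poly_DERIV] simp: field_simps power2_eq_square)
      then show ?thesis
        by (rule has_field_derivative_transform_within_open[where S = "{0<..}"]) (use 1 in auto)
    next
      case 2
      have "((\<lambda>x. 0) has_field_derivative ?f ?p' x) (at x)" using 2 by auto
      then show ?thesis
        by (rule has_field_derivative_transform_within_open[where S = "{..<0}"]) (use 2 in auto)
    next
      case 3
      \<comment> \<open>At 0 the right difference quotient is \<open>s p(s) exp(-s)\<close> with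
        \<open>s = 1 / h\<close>; \<open>pCons 0 p\<close> is the polynomial
        \<open>s p(s)\<close>.\<close>
      have "((\<lambda>h. poly (pCons 0 p) (inverse h) * exp (- inverse h)) \<longlongrightarrow> 0) (at_right 0)"
        by (rule filterlim_compose[OF poly_times_exp_minus_tendsto_0 filterlim_inverse_at_top_right])
      then have r: "((\<lambda>h. (?f p (0 + h) - ?f p 0) / h) \<longlongrightarrow> 0) (at_right 0)"
        by (rule Lim_transform_eventually)
          (auto simp: eventually_at_filter field_simps)
      have l: "((\<lambda>h. (?f p (0 + h) - ?f p 0) / h) \<longlongrightarrow> 0) (at_left 0)"
        by (rule Lim_transform_eventually[OF tendsto_const]) (auto simp: eventually_at_filter)
      show ?thesis
        using filterlim_split_at[OF l r] 3 by (simp add: DERIV_def)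
    qed
  qed
  then show ?case using Suc.IH[of ?p'] by (rule kdiff_SucI)
qed simp

definition flat :: "real \<Rightarrow> real" where
  "flat x = (if x > 0 then exp (- (1 / x)) else 0)"

text \<open>This quotient is exactly 0 up to 0 and exactly 1 from 1 on, so differences of its
  translates have bounded support.\<close>

definition smooth_step :: "real \<Rightarrow> real" where
  "smooth_step x = flat x * inverse (flat x + flat (1 - x))"

lemma flat_nonneg: "0 \<le> flat x" and flat_pos: "0 < x \<Longrightarrow> 0 < flat x"
  by (auto simp: flat_def)

text \<open>At least one of \<open>x\<close> and \<open>1 - x\<close> is positive.\<close>

lemma flat_sum_pos: "0 < flat x + flat (1 - x)"
  using flat_nonneg[of x] flat_nonneg[of "1 - x"] flat_pos[of x] flat_pos[of "1 - x"] by fastforce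

lemma kdiff_smooth_step: "kdiff n smooth_step"
proof -
  have f: "kdiff n flat"
    using kdiff_flat[of n "[:1:]"] by (simp add: flat_def[abs_def] cong: if_cong)
  have "kdiff n (\<lambda>x. flat (1 - x))"
    using kdiff_affine[OF f, of "-1" 1] by simp
  then show ?thesis
    unfolding smooth_step_def[abs_def]
    using f flat_sum_pos by (intro kdiff_mult kdiff_inverse kdiff_add) (auto simp: less_le)
qed

lemma smooth_step_le_0: "x \<le> 0 \<Longrightarrow> smooth_step x = 0"
  and smooth_step_ge_1: "1 \<le> x \<Longrightarrow> smooth_step x = 1"
  by (auto simp: smooth_step_def flat_def)

lemma smooth_step_bounds: "0 \<le> smooth_step x" "smooth_step x \<le> 1"
  using flat_sum_pos[of x] flat_nonneg[of x] flat_nonneg[of "1-x"]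
  by (auto simp: smooth_step_def field_simps)

lemma smooth_step_has_derivative: "(smooth_step has_field_derivative deriv smooth_step x) (at x)"
  and isCont_deriv_smooth_step: "isCont (deriv smooth_step) x"
  using kdiff_smooth_step[of 2]
  by (auto simp: numeral_2_eq_2 DERIV_deriv_iff_field_differentiable
      intro: field_differentiable_imp_continuous_at)

lemma test_function_iff:
  "test_function \<phi> \<longleftrightarrow> (\<forall>n. kdiff n \<phi>) \<and> bounded {x. \<phi> x \<noteq> 0}"
  unfolding test_function_def kdiff_iff by (auto simp: compact_closure)

text \<open>Both steps are 0 to the left of \<open>min a b\<close>, and both are 1 once their ramps
  of width \<open>1 / n\<close> have ended, so they cancel outside a bounded interval. For
  \<open>a \<le> b\<close> and large \<open>n\<close> the difference approximates the indicator of
  the interval from \<open>a\<close> to \<open>b\<close>.\<close>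

lemma test_function_step:
  assumes "n > 0"
  shows "test_function (\<lambda>x. smooth_step (n * (x - a)) - smooth_step (n * (x - b)))"
proof -
  have k: "kdiff m (\<lambda>x. smooth_step (n * (x - c)))" for m c
    using kdiff_affine[OF kdiff_smooth_step[of m], of n "- n * c"] by (simp add: algebra_simps)
  have "{x. smooth_step (n * (x - a)) - smooth_step (n * (x - b)) \<noteq> 0} \<subseteq> {min a b..max a b + 1 / n}"
  proof -
    have "smooth_step (n * (x - a)) - smooth_step (n * (x - b)) = 0" if "x \<notin> {min a b..max a b + 1 / n}" for x
    proof (cases "x < min a b")
      case True
      then show ?thesis using assms by (simp add: smooth_step_le_0 mult_nonneg_nonpos)
    next
      case False
      then have "x - a \<ge> 1 / n" "x - b \<ge> 1 / n" using that by auto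
      then show ?thesis using assms by (simp add: smooth_step_ge_1 field_simps)
    qed
    then show ?thesis by blast
  qed
  then show ?thesis
    unfolding test_function_iff using k by (auto intro!: kdiff_diff elim: bounded_subset[OF bounded_closed_interval])
qed

subsection \<open>Weak derivatives\<close>

lemma locally_integrable_measurable:
  assumes "locally_integrable g"
  shows "g \<in> borel_measurable borel"
proof (rule borel_measurable_LIMSEQ_real)
  show "(\<lambda>x. indicator {- real n..real n} x * g x) \<in> borel_measurable borel" for n
    using assms borel_measurable_integrable[of lborel "\<lambda>x. indicator {- real n..real n} x * g x"]
    by (simp add: locally_integrable_def set_integrable_def)
  show "(\<lambda>n. indicator {- real n..real n} x * g x) \<longlonglongrightarrow> g x" for x
  proof (rule tendsto_eventually)
    have "\<forall>\<^sub>F n in sequentially. \<bar>x\<bar> \<le> real n"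
      by real_asymp
    then show "\<forall>\<^sub>F n in sequentially. indicator {- real n..real n} x * g x = g x"
      by eventually_elim (auto simp: indicator_def)
  qed
qed

lemma locally_integrable_diff:
  "locally_integrable f \<Longrightarrow> locally_integrable g \<Longrightarrow> locally_integrable (\<lambda>x. f x - g x)"
  by (auto simp: locally_integrable_def intro!: set_integral_diff)

lemma continuous_locally_integrable: "continuous_on UNIV f \<Longrightarrow> locally_integrable f"
  unfolding locally_integrable_def
  by (auto intro!: borel_integrable_atLeastAtMost' continuous_on_subset[of UNIV])

lemma continuous_bounded_on_interval:
  fixes f :: "real \<Rightarrow> real"
  assumes "continuous_on UNIV f"
  obtains B where "\<And>x. x \<in> {a..b} \<Longrightarrow> \<bar>f x\<bar> \<le> B"
proof -
  have "compact (f ` {a..b})"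
    using assms by (intro compact_continuous_image) (auto intro: continuous_on_subset)
  then have "bounded (f ` {a..b})" by (rule compact_imp_bounded)
  then obtain B where "\<forall>x\<in>{a..b}. \<bar>f x\<bar> \<le> B" by (auto simp: bounded_iff)
  then show ?thesis using that by blast
qed

lemma integrable_imp_set_integrable:
  fixes f :: "real \<Rightarrow> real"
  shows "integrable lborel f \<Longrightarrow> set_integrable lborel {a..b} f"
  unfolding set_integrable_def by (intro integrable_mult_indicator) auto

lemma integrable_mult_bounded_support:
  assumes "locally_integrable f" "continuous_on UNIV h" "\<And>x. x \<notin> {a..b} \<Longrightarrow> h x = 0"
  shows "integrable lborel (\<lambda>x. f x * h x)"
proof -
  obtain B where B: "\<And>x. x \<in> {a..b} \<Longrightarrow> \<bar>h x\<bar> \<le> B"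
    using continuous_bounded_on_interval[OF assms(2)] by blast
  show ?thesis
  proof (rule Bochner_Integration.integrable_bound)
    show "integrable lborel (\<lambda>x. B * (indicator {a..b} x * f x))"
      using assms(1) by (auto simp: locally_integrable_def set_integrable_def)
    show "(\<lambda>x. f x * h x) \<in> borel_measurable lborel"
      using locally_integrable_measurable[OF assms(1)] borel_measurable_continuous_onI[OF assms(2)] by simp
    show "AE x in lborel. norm (f x * h x) \<le> norm (B * (indicator {a..b} x * f x))"
    proof (rule AE_I2)
      fix x
      show "norm (f x * h x) \<le> norm (B * (indicator {a..b} x * f x))"
        using B[of x] assms(3)[of x] 
        by (cases "x \<in> {a..b}") (auto simp: abs_mult mult.commute[of "\<bar>f x\<bar>"] intro!: mult_right_mono)
    qed
  qed
qed

section \<open>The derivative of the smooth step as an approximate identity\<close>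

lemma deriv_smooth_step_eq_0:
  assumes "y \<notin> {0..1}"
  shows "deriv smooth_step y = 0"
proof -
  consider "y < 0" | "y > 1" using assms by force
  then have "(smooth_step has_field_derivative 0) (at y)"
  proof cases
    case 1
    show ?thesis
      by (rule has_field_derivative_transform_within_open[where S = "{..<0}" and f = "\<lambda>_. 0"])
        (use 1 in \<open>auto simp: smooth_step_le_0\<close>)
  next
    case 2
    show ?thesis
      by (rule has_field_derivative_transform_within_open[where S = "{1<..}" and f = "\<lambda>_. 1"])
        (use 2 in \<open>auto simp: smooth_step_ge_1\<close>)
  qed
  then show ?thesis by (rule DERIV_imp_deriv)
qed

lemma LINT_deriv_smooth_step: "(LINT y|lborel. deriv smooth_step y) = 1"
proof -
  have "(LINT y|lborel. deriv smooth_step y * indicator {0..1} y) = smooth_step 1 - smooth_step 0"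
    by (rule integral_FTC_Icc_real)
      (auto simp: smooth_step_has_derivative isCont_deriv_smooth_step)
  moreover have "(\<lambda>y. deriv smooth_step y * indicator {0..1} y) = deriv smooth_step"
    using deriv_smooth_step_eq_0 by (auto simp: indicator_def fun_eq_iff)
  ultimately show ?thesis by (simp add: smooth_step_le_0 smooth_step_ge_1)
qed

lemma integrable_times_deriv_smooth_step:
  assumes "continuous_on UNIV u" "n > 0"
  shows "integrable lborel (\<lambda>x. u x * (n * deriv smooth_step (n * (x - c))))"
proof (rule integrable_mult_bounded_support[where a = c and b = "c + 1 / n"])
  show "locally_integrable u" using assms(1) by (rule continuous_locally_integrable)
  have "continuous_on UNIV (deriv smooth_step)"
    using isCont_deriv_smooth_step by (auto simp: continuous_on_eq_continuous_at)
  then show "continuous_on UNIV (\<lambda>x. n * deriv smooth_step (n * (x - c)))"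
    by (intro continuous_on_mult_left continuous_on_compose2[of UNIV "deriv smooth_step" UNIV "\<lambda>x. n * (x - c)"])
      (auto intro!: continuous_intros)
  fix x assume "x \<notin> {c..c + 1 / n}"
  then consider "x - c < 0" | "1 / n < x - c" by force
  then have "n * (x - c) \<notin> {0..1}"
  proof cases
    case 1
    then show ?thesis using mult_pos_neg[OF assms(2) 1] by simp
  next
    case 2
    then show ?thesis using mult_strict_left_mono[OF 2 assms(2)] assms(2) by simp
  qed
  then show "n * deriv smooth_step (n * (x - c)) = 0"
    by (simp add: deriv_smooth_step_eq_0)
qed

text \<open>The rescaled derivatives have mass 1 and are supported in
  \<open>[c, c + 1 / (k + 1)]\<close>. Substituting \<open>y = (k + 1) (x - c)\<close> moves the
  dependence on \<open>k\<close> into the argument of \<open>u\<close>, where continuity and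
  dominated convergence apply.\<close>

lemma LINT_times_deriv_smooth_step_tendsto:
  assumes u: "continuous_on UNIV u"
  shows "(\<lambda>k. LINT x|lborel. u x * (real (Suc k) * deriv smooth_step (real (Suc k) * (x - c))))
    \<longlonglongrightarrow> u c"
proof -
  have "(LINT x|lborel. u x * (real (Suc k) * deriv smooth_step (real (Suc k) * (x - c))))
    = (LINT y|lborel. u (c + inverse (real (Suc k)) * y) * deriv smooth_step y)" for k
  proof -
    have r: "real (Suc k) * (inverse (real (Suc k)) * y) = y"
      "\<bar>inverse (real (Suc k))\<bar> * (x * (real (Suc k) * y)) = x * y" for x y
      by (simp_all add: field_simps del: of_nat_Suc)
    show ?thesis
      by (subst lborel_integral_real_affine[where c = "inverse (real (Suc k))" and t = c])
        (simp_all only: add_diff_cancel_left' r real_scaleR_def flip: integral_mult_right_zero, simp)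
  qed
  moreover have "(\<lambda>k. LINT y|lborel. u (c + inverse (real (Suc k)) * y) * deriv smooth_step y)
    \<longlonglongrightarrow> (LINT y|lborel. u c * deriv smooth_step y)"
  proof -
    \<comment> \<open>For \<open>y\<close> in \<open>[0, 1]\<close> every point
      \<open>c + y / (k + 1)\<close> stays in \<open>[c, c + 1]\<close>, so one bound serves for all
      \<open>k\<close>.\<close>
    obtain B where B: "\<And>x. x \<in> {c..c + 1} \<Longrightarrow> \<bar>u x\<bar> \<le> B"
      using continuous_bounded_on_interval[OF u] by blast
    have s: "continuous_on UNIV (deriv smooth_step)"
      using isCont_deriv_smooth_step by (auto simp: continuous_on_eq_continuous_at)
    have [measurable]: "deriv smooth_step \<in> borel_measurable borel" "u \<in> borel_measurable borel"
      using s u by (auto intro: borel_measurable_continuous_onI)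
    show ?thesis
    proof (rule integral_dominated_convergence[where w = "\<lambda>y. B * \<bar>deriv smooth_step y\<bar>"])
      show "integrable lborel (\<lambda>y. B * \<bar>deriv smooth_step y\<bar>)"
        using integrable_mult_bounded_support[of "\<lambda>_. 1" "deriv smooth_step" 0 1]
          s deriv_smooth_step_eq_0 
        by (auto simp: continuous_locally_integrable)
      show "AE y in lborel. (\<lambda>k. u (c + inverse (real (Suc k)) * y) * deriv smooth_step y)
          \<longlonglongrightarrow> u c * deriv smooth_step y"
      proof (rule AE_I2)
        fix y
        have "(\<lambda>k. c + inverse (real (Suc k)) * y) \<longlonglongrightarrow> c + 0 * y"
          by (intro tendsto_intros LIMSEQ_inverse_real_of_nat)
        then have "(\<lambda>k. u (c + inverse (real (Suc k)) * y)) \<longlonglongrightarrow> u c"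
          using u by (intro isCont_tendsto_compose[of c u]) (auto simp: continuous_on_eq_continuous_at)
        then show "(\<lambda>k. u (c + inverse (real (Suc k)) * y) * deriv smooth_step y)
          \<longlonglongrightarrow> u c * deriv smooth_step y" by (intro tendsto_intros)
      qed
      show "AE y in lborel. norm (u (c + inverse (real (Suc k)) * y) * deriv smooth_step y)
          \<le> B * \<bar>deriv smooth_step y\<bar>" for k
      proof (rule AE_I2)
        fix y
        have "\<bar>u (c + inverse (real (Suc k)) * y)\<bar> \<le> B" if "y \<in> {0..1}"
          using that by (intro B) (auto simp: field_simps)
        then show "norm (u (c + inverse (real (Suc k)) * y) * deriv smooth_step y)
          \<le> B * \<bar>deriv smooth_step y\<bar>"
          using deriv_smooth_step_eq_0[of y] 
          by (cases "y \<in> {0..1}") (auto simp: abs_mult intro!: mult_right_mono)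
      qed
    qed auto
  qed
  ultimately show ?thesis by (simp add: LINT_deriv_smooth_step)
qed

section \<open>The fundamental theorem and uniqueness of weak derivatives\<close>

lemma smooth_step_tendsto:
  "(\<lambda>k. smooth_step (real (Suc k) * (x - c))) \<longlonglongrightarrow> indicator {c<..} x"
proof (cases "x > c")
  case True
  have "\<forall>\<^sub>F k in sequentially. 1 / (x - c) \<le> real (Suc k)"
    by real_asymp
  then have "\<forall>\<^sub>F k in sequentially. smooth_step (real (Suc k) * (x - c)) = indicator {c<..} x"
    by eventually_elim (use True in \<open>auto simp: smooth_step_ge_1 field_simps\<close>)
  then show ?thesis by (rule tendsto_eventually)
next
  case False
  then show ?thesis by (simp add: smooth_step_le_0 mult_nonneg_nonpos)
qed

text \<open>The weak identity is tested with \<open>\<phi> k\<close>, the difference of steps at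
  \<open>a\<close> and \<open>b\<close>. One side tends to \<open>u a - u b\<close> by the
  approximate identity, the other to minus the integral of \<open>g\<close> by dominated
  convergence.\<close>

lemma weak_deriv_FTC:
  assumes u: "continuous_on UNIV u" and g: "has_weak_deriv u g" and "a \<le> b"
  shows "u b - u a = (LINT x:{a..b}|lborel. g x)"
proof -
  define \<phi> where "\<phi> k x = smooth_step (real (Suc k) * (x - a)) - smooth_step (real (Suc k) * (x - b))" for k x
  have gi: "locally_integrable g" using g by (simp add: has_weak_deriv_def)
  have [measurable]: "g \<in> borel_measurable borel"
    using gi by (rule locally_integrable_measurable)
  have d: "(\<phi> k has_field_derivative real (Suc k) * deriv smooth_step (real (Suc k) * (x - a)) -
     real (Suc k) * deriv smooth_step (real (Suc k) * (x - b))) (at x)" for k x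
    unfolding \<phi>_def
    by (auto intro!: derivative_eq_intros DERIV_chain2[OF smooth_step_has_derivative])
  then have "continuous_on UNIV (\<phi> k)" for k
    by (auto simp: continuous_on_eq_continuous_at intro: DERIV_isCont)
  then have [measurable]: "\<phi> k \<in> borel_measurable borel" for k
    by (rule borel_measurable_continuous_onI)
  have "(LINT x|lborel. u x * deriv (\<phi> k) x) = - (LINT x|lborel. g x * \<phi> k x)" for k
    using g test_function_step[of "real (Suc k)" a b]
    unfolding has_weak_deriv_def \<phi>_def by simp
  moreover have "(LINT x|lborel. u x * deriv (\<phi> k) x) =
    (LINT x|lborel. u x * (real (Suc k) * deriv smooth_step (real (Suc k) * (x - a)))) -
    (LINT x|lborel. u x * (real (Suc k) * deriv smooth_step (real (Suc k) * (x - b))))" for k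
    unfolding DERIV_imp_deriv[OF d] right_diff_distrib[of "u _"]
    using integrable_times_deriv_smooth_step[OF u, of "real (Suc k)"]
    by (intro Bochner_Integration.integral_diff) auto
  ultimately have "(\<lambda>k. - (LINT x|lborel. g x * \<phi> k x)) \<longlonglongrightarrow> u a - u b"
    using tendsto_diff[OF LINT_times_deriv_smooth_step_tendsto[OF u, of a]
        LINT_times_deriv_smooth_step_tendsto[OF u, of b]] by simp
  moreover have "(\<lambda>k. LINT x|lborel. g x * \<phi> k x) \<longlonglongrightarrow>
    (LINT x|lborel. g x * (indicator {a<..} x - indicator {b<..} x))"
  \<comment> \<open>All \<open>\<phi> k\<close> are bounded by 1 and, the ramps having width at most
    1, vanish outside \<open>[a, b + 1]\<close>.\<close>
  proof (rule integral_dominated_convergence[where w = "\<lambda>x. \<bar>indicator {a..b+1} x * g x\<bar>"])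
    show "integrable lborel (\<lambda>x. \<bar>indicator {a..b+1} x * g x\<bar>)"
      using gi unfolding locally_integrable_def set_integrable_def by (intro integrable_abs) auto
    show "AE x in lborel. (\<lambda>k. g x * \<phi> k x) \<longlonglongrightarrow> g x * (indicator {a<..} x - indicator {b<..} x)"
      unfolding \<phi>_def by (intro AE_I2 tendsto_intros smooth_step_tendsto)
    show "AE x in lborel. norm (g x * \<phi> k x) \<le> \<bar>indicator {a..b+1} x * g x\<bar>" for k
    proof (rule AE_I2)
      fix x
      have "\<bar>\<phi> k x\<bar> \<le> 1"
        using smooth_step_bounds[of "real (Suc k) * (x - a)"] smooth_step_bounds[of "real (Suc k) * (x - b)"]
        unfolding \<phi>_def abs_le_iff by linarith
      moreover have "\<phi> k x = 0" if "x \<notin> {a..b+1}"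
      proof (cases "x < a")
        case True
        then show ?thesis using \<open>a \<le> b\<close>
          unfolding \<phi>_def by (subst (1 2) smooth_step_le_0) (auto intro: mult_nonneg_nonpos)
      next
        case False
        then have "1 * 1 \<le> real (Suc k) * (x - a)" "1 * 1 \<le> real (Suc k) * (x - b)"
          using that \<open>a \<le> b\<close> by (intro mult_mono; auto)+
        then show ?thesis unfolding \<phi>_def by (simp add: smooth_step_ge_1)
      qed
      ultimately show "norm (g x * \<phi> k x) \<le> \<bar>indicator {a..b+1} x * g x\<bar>"
        by (cases "x \<in> {a..b+1}") (auto simp: abs_mult mult_left_le)
    qed
  qed auto
  ultimately have "- (LINT x|lborel. g x * (indicator {a<..} x - indicator {b<..} x)) = u a - u b"
    by (intro LIMSEQ_unique[OF tendsto_minus])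
  \<comment> \<open>The limit of \<open>\<phi> k\<close> is the indicator of the half-open interval
    \<open>(a, b]\<close>; the missing point \<open>a\<close> is a null set.\<close>
  moreover have "(LINT x|lborel. g x * (indicator {a<..} x - indicator {b<..} x)) = (LINT x:{a..b}|lborel. g x)"
    unfolding set_lebesgue_integral_def
  proof (rule integral_cong_AE)
    show "AE x in lborel. g x * (indicator {a<..} x - indicator {b<..} x) = indicator {a..b} x *\<^sub>R g x"
      using AE_lborel_singleton[of a]
      by eventually_elim (use \<open>a \<le> b\<close> in \<open>auto simp: indicator_def\<close>)
  qed auto
  ultimately show ?thesis by simp
qed

text \<open>Lebesgue differentiation: off a negligible set, \<open>h x\<close> is the limit of the
  averages of \<open>h\<close> over \<open>[x, x + t]\<close>, all of which are 0.\<close>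

lemma AE_eq_0_if_integrals_eq_0:
  assumes h: "locally_integrable h" and z: "\<And>a b. a \<le> b \<Longrightarrow> (LINT x:{a..b}|lborel. h x) = 0"
  shows "AE x in lborel. h x = 0"
proof -
  have i: "h integrable_on cbox a b" for a b
    using h set_borel_integral_eq_integral(1)[of "{a..b}" h] by (simp add: locally_integrable_def)
  have z': "integral (cbox a b) h = 0" for a b
    using h z[of a b] set_borel_integral_eq_integral(2)[of "{a..b}" h]
    by (cases "a \<le> b") (auto simp: locally_integrable_def)
  obtain N where N: "negligible N"
    "\<And>x e. \<lbrakk>x \<notin> N; 0 < e\<rbrakk> \<Longrightarrow> \<exists>d>0. \<forall>t. 0 < t \<and> t < d \<longrightarrow>
       norm (integral (cbox x (x + t *\<^sub>R One)) h /\<^sub>R t ^ DIM(real) - h x) < e"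
    using integrable_ccontinuous_explicit[OF i] by blast
  have "h x = 0" if x: "x \<notin> N" for x
  proof (rule ccontr)
    assume "h x \<noteq> 0"
    \<comment> \<open>With tolerance \<open>norm (h x)\<close> the estimate would read
      \<open>norm (h x) < norm (h x)\<close>, so no \<open>t\<close> could lie strictly between 0
      and \<open>d\<close>.\<close>
    then have "\<exists>d>0. \<forall>t::real. \<not> (0 < t \<and> t < d)"
      using N(2)[OF x, of "norm (h x)"] unfolding z' by simp
    then show False using dense[of 0] by metis
  qed
  moreover have "AE x in lebesgue. x \<notin> N"
    using N(1) by (intro AE_not_in) (simp add: negligible_iff_null_sets)
  ultimately have "AE x in lebesgue. h x = 0" by (auto elim: eventually_mono)
  then show ?thesis by (simp add: AE_completion_iff)
qed

text \<open>By the fundamental theorem both candidates have integral \<open>u b - u a\<close> over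
  every interval.\<close>

lemma weak_deriv_unique:
  assumes "continuous_on UNIV u" "has_weak_deriv u g" "has_weak_deriv u h"
  shows "AE x in lborel. g x = h x"
proof -
  have l: "locally_integrable g" "locally_integrable h"
    using assms by (auto simp: has_weak_deriv_def)
  have "AE x in lborel. g x - h x = 0"
  proof (rule AE_eq_0_if_integrals_eq_0)
    show "locally_integrable (\<lambda>x. g x - h x)" by (intro locally_integrable_diff l)
    fix a b :: real assume "a \<le> b"
    then show "(LINT x:{a..b}|lborel. g x - h x) = 0"
      using weak_deriv_FTC[OF assms(1,2)] weak_deriv_FTC[OF assms(1,3)] l
      by (subst set_integral_diff) (auto simp: locally_integrable_def)
  qed
  then show ?thesis by simp
qed

section \<open>Classical derivatives as weak derivatives\<close>

lemma test_function_derivative: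
  assumes "test_function \<phi>"
  shows "(\<phi> has_field_derivative deriv \<phi> x) (at x)" "continuous_on UNIV (deriv \<phi>)"
proof -
  have "kdiff 2 \<phi>" using assms by (simp add: test_function_iff)
  then have *: "\<phi> field_differentiable at x" "deriv \<phi> field_differentiable at x" for x
    by (auto simp: numeral_2_eq_2)
  from *(1) show "(\<phi> has_field_derivative deriv \<phi> x) (at x)"
    by (simp add: DERIV_deriv_iff_field_differentiable)
  from *(2) show "continuous_on UNIV (deriv \<phi>)"
    by (auto simp: continuous_on_eq_continuous_at intro: field_differentiable_imp_continuous_at)
qed

lemma test_function_support:
  assumes "test_function \<phi>"
  obtains M where "M > 0" "\<And>x. M \<le> \<bar>x\<bar> \<Longrightarrow> \<phi> x = 0" "\<And>x. x \<notin> {-M..M} \<Longrightarrow> deriv \<phi> x = 0"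
proof -
  have "bounded {x. \<phi> x \<noteq> 0}" using assms by (simp add: test_function_iff)
  then obtain B where "B > 0" "\<And>x. \<phi> x \<noteq> 0 \<Longrightarrow> \<bar>x\<bar> \<le> B" unfolding bounded_pos by auto
  \<comment> \<open>Enlarging the bound by 1 makes \<open>\<phi>\<close> vanish at the endpoints
    too, where the boundary terms of the integration by parts are evaluated.\<close>
  then have M: "B + 1 > 0" "\<And>x. B + 1 \<le> \<bar>x\<bar> \<Longrightarrow> \<phi> x = 0" by fastforce+
  moreover have "deriv \<phi> x = 0" if "x \<notin> {-(B + 1)..B + 1}" for x
  proof (rule DERIV_imp_deriv)
    show "(\<phi> has_field_derivative 0) (at x)"
      by (rule has_field_derivative_transform_within_open[where S = "- {-(B + 1)..B + 1}" and f = "\<lambda>_. 0"])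
        (use that M in \<open>auto simp: abs_if\<close>)
  qed
  ultimately show ?thesis using that by blast
qed

text \<open>Integration by parts: \<open>u \<phi>\<close> is a continuous antiderivative of
  \<open>u \<phi>' + g \<phi>\<close> off the finite set \<open>S\<close> and vanishes at both ends
  of a large interval. The set \<open>S\<close> accommodates the corner of the pinned state at
  0.\<close>

lemma has_weak_derivI:
  assumes u: "continuous_on UNIV u" and S: "finite S"
    and d: "\<And>x. x \<notin> S \<Longrightarrow> (u has_field_derivative g x) (at x)" and g: "locally_integrable g"
  shows "has_weak_deriv u g"
proof -
  have "(LINT x|lborel. u x * deriv \<phi> x) = - (LINT x|lborel. g x * \<phi> x)" if \<phi>: "test_function \<phi>" for \<phi>
  proof -
    note d\<phi> = test_function_derivative[OF \<phi>]
    have c\<phi>: "continuous_on UNIV \<phi>"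
      using d\<phi>(1) by (auto simp: continuous_on_eq_continuous_at intro: DERIV_isCont)
    obtain M where M: "M > 0" "\<And>x. M \<le> \<bar>x\<bar> \<Longrightarrow> \<phi> x = 0" "\<And>x. x \<notin> {-M..M} \<Longrightarrow> deriv \<phi> x = 0"
      using test_function_support[OF \<phi>] by blast
    have i: "integrable lborel (\<lambda>x. u x * deriv \<phi> x)" "integrable lborel (\<lambda>x. g x * \<phi> x)"
      using M by (auto intro!: integrable_mult_bounded_support[where a = "-M" and b = M]
          continuous_locally_integrable u g d\<phi> c\<phi>)
    have "((\<lambda>x. u x * deriv \<phi> x + g x * \<phi> x) has_integral u M * \<phi> M - u (-M) * \<phi> (-M)) {-M..M}"
    proof (rule fundamental_theorem_of_calculus_interior_strong[OF S])
      show "((\<lambda>x. u x * \<phi> x) has_vector_derivative u x * deriv \<phi> x + g x * \<phi> x) (at x)"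
        if "x \<in> {-M<..<M} - S" for x
        using that unfolding has_real_derivative_iff_has_vector_derivative[symmetric]
        by (auto intro!: DERIV_mult' d d\<phi>)
      show "continuous_on {-M..M} (\<lambda>x. u x * \<phi> x)"
        by (intro continuous_on_mult continuous_on_subset[OF u] continuous_on_subset[OF c\<phi>]) auto
    qed (use M in auto)
    then have "integral {-M..M} (\<lambda>x. u x * deriv \<phi> x + g x * \<phi> x) = 0"
      using M by (simp add: integral_unique)
    moreover have "(LINT x:{-M..M}|lborel. u x * deriv \<phi> x + g x * \<phi> x) =
        integral {-M..M} (\<lambda>x. u x * deriv \<phi> x + g x * \<phi> x)"
      by (intro set_borel_integral_eq_integral(2) integrable_imp_set_integrable Bochner_Integration.integrable_add i)
    moreover have "(LINT x:{-M..M}|lborel. u x * deriv \<phi> x + g x * \<phi> x) =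
        (LINT x|lborel. u x * deriv \<phi> x + g x * \<phi> x)"
      unfolding set_lebesgue_integral_def
      by (rule Bochner_Integration.integral_cong) (use M(2,3) in \<open>force simp: indicator_def\<close>)+
    ultimately show ?thesis using i by simp
  qed
  then show ?thesis
    using g continuous_locally_integrable[OF u] by (simp add: has_weak_deriv_def)
qed

lemma L2_locally_integrable:
  assumes "g \<in> L2"
  shows "locally_integrable g"
  unfolding locally_integrable_def
proof (intro allI)
  fix a b :: real
  have [measurable]: "g \<in> borel_measurable borel" and i: "integrable lborel (\<lambda>x. (g x)\<^sup>2)"
    using assms by (auto simp: L2_def)
  have "set_integrable lborel {a..b} (\<lambda>x. 1 + (g x)\<^sup>2)"
    using integrable_imp_set_integrable[OF i]
    by (intro set_integral_add) (auto intro: borel_integrable_atLeastAtMost')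
  then show "set_integrable lborel {a..b} g"
  proof (rule set_integrable_bound)
    \<comment> \<open>This makes \<open>1 + g^2\<close>, which is integrable on bounded intervals, a
      majorant of \<open>g\<close>.\<close>
    have "\<bar>y\<bar> \<le> 1 + y\<^sup>2" for y :: real
      using zero_le_power2[of "\<bar>y\<bar> - 1"] zero_le_power2[of y] by (simp add: power2_diff)
    then show "AE x in lborel. x \<in> {a..b} \<longrightarrow> norm (g x) \<le> norm (1 + (g x)\<^sup>2)"
      by (auto intro: order_trans[OF _ abs_ge_self])
  qed (simp add: set_borel_measurable_def)
qed

subsection \<open>Lower bounds for the energy\<close>

text \<open>The mean value theorem gives a point between \<open>u s\<close> and \<open>u t\<close>,
  and the intermediate value theorem writes it as \<open>u r\<close>. This stands in for the chain
  rule where \<open>u\<close> is only continuous.\<close>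

lemma mean_value_along:
  fixes F F' u :: "real \<Rightarrow> real"
  assumes F: "\<And>y. (F has_field_derivative F' y) (at y)" and u: "continuous_on {s..t} u" and "s \<le> t"
  obtains r where "r \<in> {s..t}" "F (u t) - F (u s) = F' (u r) * (u t - u s)"
proof -
  consider "u s < u t" | "u t < u s" | "u s = u t" by linarith
  then show ?thesis
  proof cases
    case 1
    then obtain z where z: "u s < z" "z < u t" "F (u t) - F (u s) = (u t - u s) * F' z"
      using MVT2[OF 1, of F F'] F by auto
    obtain r where "s \<le> r" "r \<le> t" "u r = z"
      using IVT'[of u s z t] z u \<open>s \<le> t\<close> by auto
    then show ?thesis using z that[of r] by simp
  next
    case 2
    then obtain z where z: "u t < z" "z < u s" "F (u s) - F (u t) = (u s - u t) * F' z"
      using MVT2[OF 2, of F F'] F by auto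
    obtain r where "s \<le> r" "r \<le> t" "u r = z"
      using IVT2'[of u t z s] z u \<open>s \<le> t\<close> by auto
    then show ?thesis using z that[of r] by (simp add: algebra_simps)
  next
    case 3
    then show ?thesis using that[of s] \<open>s \<le> t\<close> by simp
  qed
qed

text \<open>The derivative is a separate argument, so that any weak derivative of \<open>u\<close>
  can be used in place of the chosen one.\<close>

definition energy_density :: "(real \<Rightarrow> real) \<Rightarrow> (real \<Rightarrow> real) \<Rightarrow> real \<Rightarrow> real" where
  "energy_density g u x = (g x)\<^sup>2 / 2 + (1 - cos (u x))"

lemma energy_density_nonneg: "0 \<le> energy_density g u x"
  by (simp add: energy_density_def)

lemma one_minus_cos: "1 - cos (y::real) = 2 * (sin (y / 2))\<^sup>2"
  using cos_double_sin[of "y / 2"] by simp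

lemma one_minus_cos_le: "1 - cos (y::real) \<le> y\<^sup>2 / 2"
proof -
  have "\<bar>sin (y / 2)\<bar>\<^sup>2 \<le> \<bar>y / 2\<bar>\<^sup>2"
    by (intro power_mono abs_sin_x_le_abs_x) auto
  then show ?thesis by (simp add: one_minus_cos power_divide)
qed

text \<open>The difference of the two sides is half the square of
  \<open>g x - 2 * \<sigma> * sin (u x / 2)\<close>; the sign \<open>\<sigma>\<close> selects one of
  the two first order equations.\<close>

lemma sin_mult_le_energy_density:
  assumes "\<bar>\<sigma>\<bar> = (1::real)"
  shows "2 * \<sigma> * sin (u x / 2) * g x \<le> energy_density g u x"
proof -
  have "\<sigma>\<^sup>2 = 1" using assms by (metis one_power2 power2_abs)
  then have "energy_density g u x - 2 * \<sigma> * sin (u x / 2) * g x = (g x - 2 * \<sigma> * sin (u x / 2))\<^sup>2 / 2"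
    unfolding energy_density_def one_minus_cos by (simp add: power2_diff power_mult_distrib algebra_simps)
  then show ?thesis by (metis diff_ge_0_iff_ge zero_le_divide_iff zero_le_numeral zero_le_power2)
qed

text \<open>With \<open>F(y) = -4 \<sigma> cos (y / 2)\<close> the claim bounds the increment of
  \<open>F\<close> along \<open>u\<close>. On short intervals \<open>F'\<close> is nearly constant
  along \<open>u\<close>, and the increment of \<open>u\<close> is the integral of \<open>g\<close>;
  the resulting estimate is additive over adjacent intervals, so bisection (\<open>Bolzano\<close>)
  extends it to \<open>[a, b]\<close>.\<close>

lemma cos_diff_le_integral_energy_density:
  fixes \<sigma> :: real
  assumes u: "continuous_on UNIV u" and g: "has_weak_deriv u g"
    and i: "integrable lborel (energy_density g u)" and \<sigma>: "\<bar>\<sigma>\<bar> = 1" and "a \<le> b"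
  shows "4 * \<sigma> * (cos (u a / 2) - cos (u b / 2)) \<le> integral {a..b} (energy_density g u)"
proof -
  have gi: "set_integrable lborel {s..t} g" for s t
    using g by (simp add: has_weak_deriv_def locally_integrable_def)
  have ig: "g integrable_on {s..t}" "(\<lambda>x. \<bar>g x\<bar>) integrable_on {s..t}" for s t
    using set_borel_integral_eq_integral(1)[OF gi] set_borel_integral_eq_integral(1)[OF set_integrable_abs[OF gi]]
    by auto
  have id: "energy_density g u integrable_on {s..t}" for s t
    by (intro set_borel_integral_eq_integral(1) integrable_imp_set_integrable i)
  define F F' where "F y = - 4 * \<sigma> * cos (y / 2)" and "F' y = 2 * \<sigma> * sin (y / 2)" for y
  have F: "(F has_field_derivative F' y) (at y)" for y
    unfolding F_def F'_def by (auto intro!: derivative_eq_intros)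
  \<comment> \<open>The extra term \<open>e * \<bar>g x\<bar>\<close> absorbs the error of freezing
    \<open>F'\<close> at a single point of a short interval.\<close>
  have le: "F (u b) - F (u a) \<le> integral {a..b} (\<lambda>x. energy_density g u x + e * \<bar>g x\<bar>)" if "e > 0" for e
    using \<open>a \<le> b\<close>
  proof (induction rule: Bolzano)
    case (trans r s t)
    have "(\<lambda>x. energy_density g u x + e * \<bar>g x\<bar>) integrable_on {r..t}"
      by (intro integrable_add id integrable_on_mult_right ig)
    from Henstock_Kurzweil_Integration.integral_combine[OF trans(3,4) this] show ?case
      using trans(1,2) by linarith
  next
    case (local x)
    have "isCont (\<lambda>y. F' (u y)) x"
      unfolding F'_def using u by (auto intro!: continuous_intros simp: continuous_on_eq_continuous_at)
    then obtain d where d: "d > 0" "\<And>y. \<bar>y - x\<bar> < d \<Longrightarrow> \<bar>F' (u y) - F' (u x)\<bar> < e / 2"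
      using \<open>e > 0\<close> unfolding continuous_at_eps_delta by (metis dist_real_def half_gt_zero)
    have "F (u t) - F (u s) \<le> integral {s..t} (\<lambda>x. energy_density g u x + e * \<bar>g x\<bar>)"
      if st: "s \<le> x" "x \<le> t" "t - s < d" for s t
    proof -
      have "continuous_on {s..t} u" using u by (rule continuous_on_subset) auto
      then obtain r where r: "r \<in> {s..t}" "F (u t) - F (u s) = F' (u r) * (u t - u s)"
        using mean_value_along[OF F] st by (metis order_trans)
      have "u t - u s = integral {s..t} g"
        using weak_deriv_FTC[OF u g, of s t] set_borel_integral_eq_integral(2)[OF gi, of s t] st by simp
      then have "F (u t) - F (u s) = integral {s..t} (\<lambda>x. F' (u r) * g x)"
        using r(2) by simp
      also have "\<dots> \<le> integral {s..t} (\<lambda>x. energy_density g u x + e * \<bar>g x\<bar>)"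
      proof (rule integral_le)
        show "(\<lambda>x. F' (u r) * g x) integrable_on {s..t}" by (intro integrable_on_mult_right ig)
        show "(\<lambda>x. energy_density g u x + e * \<bar>g x\<bar>) integrable_on {s..t}"
          by (intro integrable_add id integrable_on_mult_right ig)
        fix y assume y: "y \<in> {s..t}"
        \<comment> \<open>Both \<open>r\<close> and \<open>y\<close> lie within \<open>d\<close> of
          \<open>x\<close>, so each value of \<open>F'\<close> is within \<open>e / 2\<close> of the
          one at \<open>x\<close>.\<close>
        have "\<bar>F' (u r) - F' (u x)\<bar> < e / 2" "\<bar>F' (u y) - F' (u x)\<bar> < e / 2"
          using r(1) y st by (intro d(2); auto)+
        then have "\<bar>F' (u r) - F' (u y)\<bar> \<le> e" by linarith
        then have "\<bar>(F' (u r) - F' (u y)) * g y\<bar> \<le> e * \<bar>g y\<bar>"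
          unfolding abs_mult by (rule mult_right_mono) auto
        moreover have "F' (u y) * g y \<le> energy_density g u y"
          unfolding F'_def by (rule sin_mult_le_energy_density[OF \<sigma>])
        ultimately show "F' (u r) * g y \<le> energy_density g u y + e * \<bar>g y\<bar>"
          unfolding left_diff_distrib abs_le_iff by linarith
      qed
      finally show ?thesis .
    qed
    then show ?case using d(1) by blast
  qed
  have "F (u b) - F (u a) \<le> integral {a..b} (energy_density g u)"
  proof (rule field_le_epsilon)
    fix e :: real assume "e > 0"
    define G where "G = integral {a..b} (\<lambda>x. \<bar>g x\<bar>)"
    have "G \<ge> 0" unfolding G_def by (intro integral_nonneg ig) auto
    \<comment> \<open>Scaling by \<open>G + 1\<close>, positive even if \<open>G = 0\<close>, keeps
      the total error below \<open>e\<close>.\<close>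
    have "F (u b) - F (u a) \<le> integral {a..b} (\<lambda>x. energy_density g u x + e / (G + 1) * \<bar>g x\<bar>)"
      using \<open>e > 0\<close> \<open>G \<ge> 0\<close> by (intro le) auto
    also have "\<dots> = integral {a..b} (energy_density g u) + e / (G + 1) * G"
      unfolding G_def
      by (subst Henstock_Kurzweil_Integration.integral_add) (intro id integrable_on_mult_right ig | simp)+
    also have "e / (G + 1) * G \<le> e" using \<open>e > 0\<close> \<open>G \<ge> 0\<close> by (simp add: field_simps)
    finally show "F (u b) - F (u a) \<le> integral {a..b} (energy_density g u) + e" by simp
  qed
  then show ?thesis by (simp add: F_def algebra_simps)
qed

section \<open>Passage from intervals to the whole line\<close>

lemma integral_le_LINT:
  fixes f :: "real \<Rightarrow> real"
  assumes "integrable lborel f" "\<And>x. 0 \<le> f x"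
  shows "integral {a..b} f \<le> (LINT x|lborel. f x)"
proof -
  have s: "set_integrable lborel {a..b} f"
    using assms(1) by (rule integrable_imp_set_integrable)
  have "integral {a..b} f = (LINT x:{a..b}|lborel. f x)"
    using set_borel_integral_eq_integral(2)[OF s] by simp
  also have "\<dots> \<le> (LINT x|lborel. f x)"
    unfolding set_lebesgue_integral_def
    by (rule integral_mono) (use s assms in \<open>auto simp: set_integrable_def indicator_def\<close>)
  finally show ?thesis .
qed

text \<open>If \<open>f^2\<close> were at least \<open>e\<close> on an interval of length
  \<open>r\<close>, its integral would be at least \<open>r * e\<close>, more than the whole
  integral. For \<open>u\<close> in \<open>L2\<close> this supplies the nearly vanishing end values
  used in place of limits at infinity.\<close>

lemma L2_small_in_interval:
  assumes "f \<in> L2" "e > 0"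
  obtains r where "r \<ge> 0" "\<And>c. \<exists>x\<in>{c..c + r}. (f x)\<^sup>2 < e"
proof -
  define I where "I = (LINT x|lborel. (f x)\<^sup>2)"
  \<comment> \<open>Chosen so that \<open>r * e = I + e\<close> exceeds \<open>I\<close>.\<close>
  define r where "r = I / e + 1"
  have i: "integrable lborel (\<lambda>x. (f x)\<^sup>2)" using assms(1) by (simp add: L2_def)
  have "I \<ge> 0" unfolding I_def by simp
  then have "r \<ge> 0" using assms(2) by (simp add: r_def)
  have "\<exists>x\<in>{c..c + r}. (f x)\<^sup>2 < e" for c
  proof (rule ccontr)
    assume *: "\<not> ?thesis"
    have s: "(\<lambda>x. (f x)\<^sup>2) integrable_on {c..c + r}"
      by (intro set_borel_integral_eq_integral(1) integrable_imp_set_integrable i)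
    have "integral {c..c + r} (\<lambda>_. e) \<le> integral {c..c + r} (\<lambda>x. (f x)\<^sup>2)"
      by (rule integral_le) (use s * in \<open>auto simp: not_less\<close>)
    also have "\<dots> \<le> I" unfolding I_def by (rule integral_le_LINT[OF i]) auto
    finally have "r * e \<le> I" using \<open>r \<ge> 0\<close> by simp
    then show False using assms(2) by (simp add: r_def distrib_right)
  qed
  then show ?thesis using that \<open>r \<ge> 0\<close> by blast
qed

lemma LINT_energy_density_ge_H1:
  assumes u: "continuous_on UNIV u" and g: "has_weak_deriv u g"
    and i: "integrable lborel (energy_density g u)" and "u \<in> L2"
  shows "8 * (1 - cos (u 0 / 2)) \<le> (LINT x|lborel. energy_density g u x)"
proof (rule field_le_epsilon)
  fix e :: real assume "e > 0"
  then obtain r where r: "r \<ge> 0" "\<And>c. \<exists>x\<in>{c..c + r}. (u x)\<^sup>2 < e"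
    using L2_small_in_interval[OF \<open>u \<in> L2\<close>] by blast
  obtain b where b: "b \<ge> 0" "(u b)\<^sup>2 < e" using r(2)[of 0] by auto
  obtain a where a: "a \<le> 0" "(u a)\<^sup>2 < e" using r(2)[of "- r"] by auto
  have "energy_density g u integrable_on {a..b}"
    by (intro set_borel_integral_eq_integral(1) integrable_imp_set_integrable i)
  then have "integral {a..0} (energy_density g u) + integral {0..b} (energy_density g u) =
      integral {a..b} (energy_density g u)"
    using a b by (intro Henstock_Kurzweil_Integration.integral_combine) auto
  also have "\<dots> \<le> (LINT x|lborel. energy_density g u x)"
    by (intro integral_le_LINT i energy_density_nonneg)
  \<comment> \<open>The sign is \<open>1\<close> on \<open>[a, 0]\<close> and \<open>-1\<close> on
    \<open>[0, b]\<close>, so that both halves bound the descent of \<open>cos (u / 2)\<close>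
    towards its value at 0.\<close>
  finally have "4 * (cos (u a / 2) - cos (u 0 / 2)) + 4 * (cos (u b / 2) - cos (u 0 / 2))
      \<le> (LINT x|lborel. energy_density g u x)"
    using cos_diff_le_integral_energy_density[OF u g i, of 1 a 0]
      cos_diff_le_integral_energy_density[OF u g i, of "-1" 0 b] a b by simp
  \<comment> \<open>Since \<open>1 - cos (v / 2)\<close> is at most \<open>v^2 / 8\<close>, each end
    costs at most \<open>e / 2\<close>.\<close>
  moreover have "4 * (1 - cos (u a / 2)) \<le> e / 2" "4 * (1 - cos (u b / 2)) \<le> e / 2"
    using one_minus_cos_le[of "u a / 2"] one_minus_cos_le[of "u b / 2"] a b
    by (simp_all add: power_divide)
  ultimately show "8 * (1 - cos (u 0 / 2)) \<le> (LINT x|lborel. energy_density g u x) + e"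
    by argo
qed

lemma LINT_energy_density_ge_kink:
  assumes u: "continuous_on UNIV u" and g: "has_weak_deriv u g"
    and i: "integrable lborel (energy_density g u)"
    and l: "(u \<longlongrightarrow> 0) at_bot" "(u \<longlongrightarrow> 2 * pi) at_top"
  shows "8 \<le> (LINT x|lborel. energy_density g u x)" (is "_ \<le> ?I")
proof -
  \<comment> \<open>One sign serves on the whole line, as \<open>cos (u / 2)\<close> goes from 1 to
    -1. The limits are taken one after the other, first in \<open>a\<close>, then in
    \<open>b\<close>.\<close>
  have le: "4 * (cos (u a / 2) - cos (u b / 2)) \<le> ?I" if "a \<le> b" for a b
    using cos_diff_le_integral_energy_density[OF u g i, of 1 a b] that
      integral_le_LINT[OF i energy_density_nonneg, of a b] by simp
  have "4 * (cos (0 / 2) - cos (u b / 2)) \<le> ?I" for b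
  proof (rule tendsto_upperbound)
    show "((\<lambda>a. 4 * (cos (u a / 2) - cos (u b / 2))) \<longlongrightarrow> 4 * (cos (0 / 2) - cos (u b / 2))) at_bot"
      by (intro tendsto_intros l) auto
    show "\<forall>\<^sub>F a in at_bot. 4 * (cos (u a / 2) - cos (u b / 2)) \<le> ?I"
      using eventually_le_at_bot[of b] by eventually_elim (rule le)
  qed auto
  then have "4 * (cos (0 / 2) - cos (2 * pi / 2)) \<le> ?I"
    by (intro tendsto_upperbound[where F = at_top and f = "\<lambda>b. 4 * (cos (0 / 2) - cos (u b / 2))"]
        tendsto_intros l) auto
  then show ?thesis by simp
qed

text \<open>Existence of \<open>g\<close> ensures that the chosen \<open>weak_deriv u\<close> is a
  weak derivative, and uniqueness makes it agree with \<open>g\<close> almost everywhere.\<close>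

lemma energy_eq:
  assumes u: "continuous_on UNIV u" and g: "has_weak_deriv u g"
  shows "energy q u (\<lambda>_. 0) = (LINT x|lborel. energy_density g u x) + q * (1 - cos (u 0))"
proof -
  have w: "has_weak_deriv u (weak_deriv u)" unfolding weak_deriv_def using g by (rule someI[where P = "has_weak_deriv u"])
  have [measurable]: "g \<in> borel_measurable borel" "weak_deriv u \<in> borel_measurable borel" "u \<in> borel_measurable borel"
    using g w by (auto simp: has_weak_deriv_def intro: locally_integrable_measurable)
  have "(LINT x|lborel. 1/2 * \<bar>0\<bar>\<^sup>2 + 1/2 * \<bar>weak_deriv u x\<bar>\<^sup>2 + (1 - cos (u x))) =
    (LINT x|lborel. energy_density g u x)"
  proof (rule integral_cong_AE)
    show "AE x in lborel. 1/2 * \<bar>0\<bar>\<^sup>2 + 1/2 * \<bar>weak_deriv u x\<bar>\<^sup>2 + (1 - cos (u x)) = energy_density g u x"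
      using weak_deriv_unique[OF u w g] by eventually_elim (simp add: energy_density_def)
  qed (simp_all add: energy_density_def[abs_def])
  then show ?thesis by (simp add: energy_def)
qed

section \<open>Energy bounds on the two function spaces\<close>

lemma integrable_energy_density:
  assumes "g \<in> L2" "(\<lambda>x. sin (u x / 2)) \<in> L2"
  shows "integrable lborel (energy_density g u)"
  using assms unfolding energy_density_def[abs_def] one_minus_cos L2_def by auto

lemma sin_half_L2:
  assumes "u \<in> L2"
  shows "(\<lambda>x. sin (u x / 2)) \<in> L2"
proof -
  have [measurable]: "u \<in> borel_measurable borel" using assms by (simp add: L2_def)
  have "integrable lborel (\<lambda>x. (sin (u x / 2))\<^sup>2)"
  proof (rule Bochner_Integration.integrable_bound)
    show "integrable lborel (\<lambda>x. (u x)\<^sup>2)" using assms by (simp add: L2_def)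
    have "(sin (y / 2))\<^sup>2 \<le> y\<^sup>2" for y :: real
      using one_minus_cos_le[of y] zero_le_power2[of y] unfolding one_minus_cos by linarith
    then show "AE x in lborel. norm ((sin (u x / 2))\<^sup>2) \<le> norm ((u x)\<^sup>2)" by simp
  qed simp
  then show ?thesis by (simp add: L2_def)
qed

lemma energy_ge_H1:
  assumes "u \<in> H1"
  shows "8 * (1 - cos (u 0 / 2)) + q * (1 - cos (u 0)) \<le> energy q u (\<lambda>_. 0)"
proof -
  obtain g where g: "continuous_on UNIV u" "g \<in> L2" "has_weak_deriv u g" "u \<in> L2"
    using assms by (auto simp: H1_def H1_dot_def)
  then show ?thesis
    using LINT_energy_density_ge_H1[of u g] by (simp add: energy_eq integrable_energy_density sin_half_L2)
qed

lemma energy_ge_kink: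
  assumes "u \<in> H1_sin" "(u \<longlongrightarrow> 0) at_bot" "(u \<longlongrightarrow> 2 * pi) at_top" "q \<le> 0"
  shows "8 + 2 * q \<le> energy q u (\<lambda>_. 0)"
proof -
  obtain g where g: "continuous_on UNIV u" "g \<in> L2" "has_weak_deriv u g" "(\<lambda>x. sin (u x / 2)) \<in> L2"
    using assms by (auto simp: H1_sin_def H1_dot_def)
  \<comment> \<open>A negative \<open>q\<close> favours the largest value of
    \<open>1 - cos (u 0)\<close>, which is 2, attained by the kink with value \<open>pi\<close> at
    0.\<close>
  have "q * 2 \<le> q * (1 - cos (u 0))"
    using \<open>q \<le> 0\<close> cos_ge_minus_one[of "u 0"] by (intro mult_left_mono_neg) auto
  then show ?thesis
    using LINT_energy_density_ge_kink[of u g] g assms by (simp add: energy_eq integrable_energy_density)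
qed

subsection \<open>The minimisers\<close>

text \<open>This is \<open>t\<close> times the derivative of \<open>4 arctan t\<close>, and also
  \<open>2 sin (2 arctan t)\<close>.\<close>

definition slope :: "real \<Rightarrow> real" where
  "slope t = 4 * t / (1 + t\<^sup>2)"

lemma slope_nonneg: "0 \<le> t \<Longrightarrow> 0 \<le> slope t"
  by (simp add: slope_def)

text \<open>For \<open>t = exp x\<close> this is the reflection of \<open>x\<close>, which gives the
  kink the same energy density on both half lines.\<close>

lemma slope_inverse: "t \<noteq> 0 \<Longrightarrow> slope (inverse t) = slope t"
  by (simp add: slope_def field_simps power2_eq_square)

lemma slope_exp_abs: "slope (exp (- \<bar>x\<bar>)) = slope (exp x)"
  using slope_inverse[of "exp x"] by (auto simp: abs_if exp_minus)

lemma measurable_slope [measurable]: "slope \<in> borel_measurable borel"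
  unfolding slope_def[abs_def] by measurable

lemma continuous_slope: "continuous_on UNIV slope"
proof -
  have "1 + t\<^sup>2 \<noteq> 0" for t :: real using zero_le_power2[of t] by linarith
  then show ?thesis unfolding slope_def[abs_def] by (intro continuous_intros) auto
qed

text \<open>Equality in the Bogomolny inequality: \<open>2 sin (u / 2) = \<plusminus> u'\<close> for \<open>u = 4 arctan t\<close> and
  \<open>t = k exp (\<plusminus> x)\<close>, since then \<open>\<bar>u'\<bar> = slope t\<close>.\<close>

lemma one_minus_cos_4_arctan: "1 - cos (4 * arctan t) = (slope t)\<^sup>2 / 2"
proof -
  have p: "1 + t\<^sup>2 > 0" using zero_le_power2[of t] by linarith
  have "2 * sin (4 * arctan t / 2) = 4 * (sin (arctan t) * cos (arctan t))"
    using sin_double[of "arctan t"] by simp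
  also have "\<dots> = slope t"
    using p by (simp add: sin_arctan cos_arctan slope_def real_sqrt_mult_self)
  finally have *: "sin (4 * arctan t / 2) = slope t / 2" by simp
  show ?thesis unfolding one_minus_cos * by (simp add: power_divide)
qed

section \<open>Derivatives and integrals of the profiles\<close>

lemma DERIV_4_arctan_exp:
  "((\<lambda>x. 4 * arctan (k * exp (s * x))) has_field_derivative s * slope (k * exp (s * x))) (at x)"
proof -
  have "1 + (k * exp (s * x))\<^sup>2 > 0" using zero_le_power2[of "k * exp (s * x)"] by linarith
  then show ?thesis
    unfolding slope_def by (auto intro!: derivative_eq_intros simp: field_simps)
qed

lemma slope_exp_half_line:
  fixes k :: real
  shows "integrable lborel (\<lambda>x. indicator {..<0} x * (slope (k * exp x))\<^sup>2)"
    and "(LINT x|lborel. indicator {..<0} x * (slope (k * exp x))\<^sup>2) = 8 - 8 / (1 + k\<^sup>2)"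
proof -
  \<comment> \<open>An antiderivative of the squared slope, with limit \<open>-8\<close> at minus
    infinity and value \<open>-8 / (1 + k^2)\<close> at 0.\<close>
  define F where "F x = - 8 / (1 + (k * exp x)\<^sup>2)" for x
  have p: "1 + (k * exp x)\<^sup>2 \<noteq> 0" "1 + k\<^sup>2 \<noteq> 0" for x :: real
    using zero_le_power2[of "k * exp x"] zero_le_power2[of k] by linarith+
  have F: "(F has_field_derivative (slope (k * exp x))\<^sup>2) (at x)" for x
    unfolding F_def slope_def using p(1)[of x]
    by (auto intro!: derivative_eq_intros simp: field_simps power2_eq_square)
  have c: "isCont (\<lambda>x. (slope (k * exp x))\<^sup>2) x" for x
    by (intro continuous_intros continuous_within_compose3[where g = slope and f = "\<lambda>x. k * exp x"])
      (use continuous_slope in \<open>auto simp: continuous_on_eq_continuous_at\<close>)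
  have A: "(F \<longlongrightarrow> - 8 / (1 + (k * 0)\<^sup>2)) at_bot"
    unfolding F_def by (intro tendsto_intros exp_at_bot) auto
  have "isCont F 0" using F by (rule DERIV_isCont)
  then have B: "(F \<longlongrightarrow> F 0) (at_left 0)"
    by (auto simp: isCont_def intro: tendsto_mono[OF at_le])
  have "set_integrable lborel (einterval (-\<infinity>) (ereal 0)) (\<lambda>x. (slope (k * exp x))\<^sup>2)"
    "(LBINT x=-\<infinity>..ereal 0. (slope (k * exp x))\<^sup>2) = F 0 - (- 8 / (1 + (k * 0)\<^sup>2))"
    using A B by (intro interval_integral_FTC_nonneg[where F = F] F c; simp add: ereal_tendsto_simps)+
  then show "integrable lborel (\<lambda>x. indicator {..<0} x * (slope (k * exp x))\<^sup>2)"
    and "(LINT x|lborel. indicator {..<0} x * (slope (k * exp x))\<^sup>2) = 8 - 8 / (1 + k\<^sup>2)"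
    by (simp_all add: set_integrable_def interval_lebesgue_integral_def set_lebesgue_integral_def F_def)
qed

text \<open>Twice the half-line integral, by reflection; the two open half lines miss only the null
  set \<open>{0}\<close>.\<close>

lemma slope_exp_abs_integral:
  fixes k :: real
  shows "integrable lborel (\<lambda>x. (slope (k * exp (- \<bar>x\<bar>)))\<^sup>2)"
    and "(LINT x|lborel. (slope (k * exp (- \<bar>x\<bar>)))\<^sup>2) = 16 - 16 / (1 + k\<^sup>2)"
proof -
  define f where "f x = indicator {..<0} x * (slope (k * exp x))\<^sup>2" for x
  have f: "integrable lborel f" "(LINT x|lborel. f x) = 8 - 8 / (1 + k\<^sup>2)"
    unfolding f_def[abs_def] by (rule slope_exp_half_line)+
  have f': "integrable lborel (\<lambda>x. f (- x))" "(LINT x|lborel. f (- x)) = 8 - 8 / (1 + k\<^sup>2)"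
    using lborel_integrable_real_affine[OF f(1), of "-1" 0] lborel_integral_real_affine[of "-1" f 0] f(2)
    by simp_all
  have [measurable]: "f \<in> borel_measurable borel" using f(1) by (simp add: borel_measurable_integrable)
  have ae: "AE x in lborel. f x + f (- x) = (slope (k * exp (- \<bar>x\<bar>)))\<^sup>2"
    using AE_lborel_singleton[of 0] by eventually_elim (auto simp: f_def indicator_def)
  have "integrable lborel (\<lambda>x. f x + f (- x)) = integrable lborel (\<lambda>x. (slope (k * exp (- \<bar>x\<bar>)))\<^sup>2)"
    by (rule integrable_cong_AE) (use ae in auto)
  then show "integrable lborel (\<lambda>x. (slope (k * exp (- \<bar>x\<bar>)))\<^sup>2)" using f f' by simp
  have "(LINT x|lborel. f x + f (- x)) = (LINT x|lborel. (slope (k * exp (- \<bar>x\<bar>)))\<^sup>2)"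
    by (rule integral_cong_AE) (use ae in auto)
  then show "(LINT x|lborel. (slope (k * exp (- \<bar>x\<bar>)))\<^sup>2) = 16 - 16 / (1 + k\<^sup>2)"
    using f f' by simp
qed

text \<open>Common to kink (\<open>k = 1\<close>) and pinned state: gradient and potential terms
  each equal half the squared slope. Only \<open>g^2\<close> is prescribed, since the sign of the
  derivative depends on the profile.\<close>

lemma profile_energy:
  assumes u: "continuous_on UNIV u" and d: "\<And>x. x \<noteq> 0 \<Longrightarrow> (u has_field_derivative g x) (at x)"
    and g: "\<And>x. (g x)\<^sup>2 = (slope (k * exp (- \<bar>x\<bar>)))\<^sup>2" and [measurable]: "g \<in> borel_measurable borel"
    and c: "\<And>x. 1 - cos (u x) = (slope (k * exp (- \<bar>x\<bar>)))\<^sup>2 / 2"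
  shows "u \<in> H1_sin" "energy q u (\<lambda>_. 0) = 16 - 16 / (1 + k\<^sup>2) + q * (1 - cos (u 0))"
proof -
  note s = slope_exp_abs_integral[of k]
  have "g \<in> L2" using s(1) by (simp add: L2_def g)
  then have w: "has_weak_deriv u g"
    by (intro has_weak_derivI[of u "{0}"] u d L2_locally_integrable) auto
  have [measurable]: "u \<in> borel_measurable borel" using u by (rule borel_measurable_continuous_onI)
  have *: "(sin (u x / 2))\<^sup>2 = (slope (k * exp (- \<bar>x\<bar>)))\<^sup>2 / 4" for x
    using c[of x] unfolding one_minus_cos by simp
  have "(\<lambda>x. sin (u x / 2)) \<in> L2" using s(1) by (simp add: L2_def *)
  then show "u \<in> H1_sin" using u w \<open>g \<in> L2\<close> by (auto simp: H1_sin_def H1_dot_def)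
  have "energy_density g u = (\<lambda>x. (slope (k * exp (- \<bar>x\<bar>)))\<^sup>2)"
    by (simp add: energy_density_def fun_eq_iff g c)
  then show "energy q u (\<lambda>_. 0) = 16 - 16 / (1 + k\<^sup>2) + q * (1 - cos (u 0))"
    using s(2) energy_eq[OF u w] by simp
qed

section \<open>Energies of the kink and the pinned state\<close>

lemma kink_energy: "kink \<in> H1_sin" "energy q kink (\<lambda>_. 0) = 8 + 2 * q"
proof -
  have d: "(kink has_field_derivative slope (exp x)) (at x)" for x
    using DERIV_4_arctan_exp[of 1 1 x] by (simp add: kink_def[abs_def])
  have u: "continuous_on UNIV kink"
    using d by (auto simp: continuous_on_eq_continuous_at intro: DERIV_isCont)
  have c: "1 - cos (kink x) = (slope (1 * exp (- \<bar>x\<bar>)))\<^sup>2 / 2" for x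
    by (simp add: kink_def one_minus_cos_4_arctan slope_exp_abs)
  have g: "(slope (exp x))\<^sup>2 = (slope (1 * exp (- \<bar>x\<bar>)))\<^sup>2" for x by (simp add: slope_exp_abs)
  have m: "(\<lambda>x. slope (exp x)) \<in> borel_measurable borel" by measurable
  show "kink \<in> H1_sin" by (rule profile_energy(1)[OF u d g m c])
  show "energy q kink (\<lambda>_. 0) = 8 + 2 * q"
    unfolding profile_energy(2)[OF u d g m c] by (simp add: kink_def arctan_one)
qed

lemma kink_limits: "(kink \<longlongrightarrow> 0) at_bot" "(kink \<longlongrightarrow> 2 * pi) at_top"
proof -
  have "(kink \<longlongrightarrow> 4 * arctan 0) at_bot"
    unfolding kink_def[abs_def] by (intro tendsto_intros exp_at_bot)
  then show "(kink \<longlongrightarrow> 0) at_bot" by simp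
  have "((\<lambda>x. arctan (exp x)) \<longlongrightarrow> pi / 2) at_top"
    by (rule filterlim_compose[OF tendsto_arctan_at_top exp_at_top])
  then have "(kink \<longlongrightarrow> 4 * (pi / 2)) at_top"
    unfolding kink_def[abs_def] by (intro tendsto_intros)
  then show "(kink \<longlongrightarrow> 2 * pi) at_top" by simp
qed

text \<open>The amplitude \<open>k\<close> makes the cosine of half the value at 0,
  \<open>(1 - k^2) / (1 + k^2)\<close>, equal to \<open>-2 / q\<close>, the minimising value of
  \<open>z\<close>.\<close>

lemma pinned_state_energy:
  assumes "q < - 2"
  shows "pinned_state q \<in> H1" "energy q (pinned_state q) (\<lambda>_. 0) = 8 + 2 * q + 8 / q"
proof -
  define k where "k = sqrt ((q + 2) / (q - 2))"
  have "(q + 2) / (q - 2) > 0" using assms by (simp add: divide_neg_neg)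
  then have k: "k > 0" "k\<^sup>2 = (q + 2) / (q - 2)" by (simp_all add: k_def)
  have q: "pinned_state q = (\<lambda>x. 4 * arctan (k * exp (- \<bar>x\<bar>)))"
    by (simp add: pinned_state_def fun_eq_iff k_def)
  \<comment> \<open>The profile rises on the left half line and falls on the right one, hence the
    jump of sign at 0.\<close>
  define g where "g x = (if x > 0 then - 1 else 1) * slope (k * exp (- \<bar>x\<bar>))" for x
  have d: "(pinned_state q has_field_derivative g x) (at x)" if "x \<noteq> 0" for x
  proof (cases "x > 0")
    case True
    show ?thesis
      by (rule has_field_derivative_transform_within_open[where S = "{0<..}",
            OF DERIV_4_arctan_exp[of k "-1" x, THEN DERIV_cong]])
        (use True in \<open>auto simp: q g_def\<close>)
  next
    case False
    show ?thesis
      by (rule has_field_derivative_transform_within_open[where S = "{..<0}",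
            OF DERIV_4_arctan_exp[of k 1 x, THEN DERIV_cong]])
        (use False that in \<open>auto simp: q g_def\<close>)
  qed
  have u: "continuous_on UNIV (pinned_state q)"
    unfolding q by (intro continuous_intros)
  have c: "1 - cos (pinned_state q x) = (slope (k * exp (- \<bar>x\<bar>)))\<^sup>2 / 2" for x
    by (simp add: q one_minus_cos_4_arctan)
  have m: "g \<in> borel_measurable borel" unfolding g_def[abs_def] by measurable
  have g: "(g x)\<^sup>2 = (slope (k * exp (- \<bar>x\<bar>)))\<^sup>2" for x
    by (simp add: g_def power_mult_distrib)
  have "pinned_state q \<in> L2"
  proof -
    have "integrable lborel (\<lambda>x. (pinned_state q x)\<^sup>2)"
    proof (rule Bochner_Integration.integrable_bound)
      show "integrable lborel (\<lambda>x. (1 + k\<^sup>2)\<^sup>2 * (slope (k * exp (- \<bar>x\<bar>)))\<^sup>2)"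
        using slope_exp_abs_integral(1) by (rule integrable_mult_right)
      \<comment> \<open>For bounded \<open>t\<close> the slope is comparable to \<open>t\<close>,
        which dominates \<open>arctan t\<close>; so square integrability is inherited from the
        slope.\<close>
      have "(4 * arctan t)\<^sup>2 \<le> (1 + k\<^sup>2)\<^sup>2 * (slope t)\<^sup>2" if "0 < t" "t \<le> k" for t
      proof -
        have "4 * arctan t \<le> 4 * t" using arctan_le_self[of t] that by simp
        also have "\<dots> = (1 + t\<^sup>2) * slope t"
          using zero_le_power2[of t] by (simp add: slope_def add_nonneg_eq_0_iff)
        also have "\<dots> \<le> (1 + k\<^sup>2) * slope t"
          using that by (intro mult_right_mono add_left_mono power_mono slope_nonneg) auto
        finally show ?thesis
          unfolding power_mult_distrib[symmetric] using that by (intro power_mono) auto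
      qed
      moreover have "0 < k * exp (- \<bar>x\<bar>)" "k * exp (- \<bar>x\<bar>) \<le> k" for x :: real
        using k(1) by (auto simp: mult_le_cancel_left1)
      ultimately show "AE x in lborel. norm ((pinned_state q x)\<^sup>2)
          \<le> norm ((1 + k\<^sup>2)\<^sup>2 * (slope (k * exp (- \<bar>x\<bar>)))\<^sup>2)"
        by (simp add: q)
    qed (simp add: q)
    then show ?thesis by (simp add: L2_def q)
  qed
  then show "pinned_state q \<in> H1"
    using profile_energy(1)[OF u d g m c] by (simp add: H1_def H1_sin_def)
  have s: "1 + k\<^sup>2 = 2 * q / (q - 2)" using k(2) assms by (simp add: field_simps)
  have "(slope k)\<^sup>2 = 16 * k\<^sup>2 / (1 + k\<^sup>2)\<^sup>2" by (simp add: slope_def power_divide power_mult_distrib)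
  also have "\<dots> = 4 * (q + 2) * (q - 2) / q\<^sup>2"
    unfolding s k(2) using assms by (simp add: field_simps power2_eq_square)
  finally have sk: "(slope k)\<^sup>2 = 4 * (q + 2) * (q - 2) / q\<^sup>2" .
  have "energy q (pinned_state q) (\<lambda>_. 0) = 16 - 16 / (1 + k\<^sup>2) + q * ((slope k)\<^sup>2 / 2)"
    using profile_energy(2)[OF u d g m c, of q] c[of 0] by simp
  also have "\<dots> = 8 + 2 * q + 8 / q"
    unfolding sk s using assms by (simp add: field_simps power2_eq_square)
  finally show "energy q (pinned_state q) (\<lambda>_. 0) = 8 + 2 * q + 8 / q" .
qed

lemma zero_energy: "(\<lambda>_. 0) \<in> H1" "energy q (\<lambda>_. 0) (\<lambda>_. 0) = 0"
proof -
  have l: "(\<lambda>_. 0) \<in> L2" by (simp add: L2_def)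
  have w: "has_weak_deriv (\<lambda>_. 0) (\<lambda>_. 0)"
    by (rule has_weak_derivI[where S = "{}"]) (auto intro: L2_locally_integrable l)
  show "(\<lambda>_. 0) \<in> H1" using w l by (auto simp: H1_def H1_dot_def)
  show "energy q (\<lambda>_. 0) (\<lambda>_. 0) = 0"
    using energy_eq[OF _ w, of q] by (simp add: energy_density_def[abs_def])
qed

text \<open>With \<open>z = cos (u 0 / 2)\<close> the lower bound
  \<open>8 (1 - z) + 2 q (1 - z^2)\<close> factorises, leaving a quadratic in one variable to
  minimise.\<close>

lemma energy_H1_ge_cos:
  assumes "u \<in> H1"
  obtains z where "\<bar>z\<bar> \<le> 1" "2 * (1 - z) * (4 + q * (1 + z)) \<le> energy q u (\<lambda>_. 0)"
proof
  show "\<bar>cos (u 0 / 2)\<bar> \<le> 1" by simp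
  have "1 - cos (u 0) = 2 * (1 - (cos (u 0 / 2))\<^sup>2)"
    unfolding one_minus_cos by (simp add: sin_squared_eq)
  then show "2 * (1 - cos (u 0 / 2)) * (4 + q * (1 + cos (u 0 / 2))) \<le> energy q u (\<lambda>_. 0)"
    using energy_ge_H1[OF assms, of q] by (simp add: algebra_simps power2_eq_square)
qed

theorem proposition1p3:
  fixes q :: real and c d :: ereal
  assumes "q < 0"
    and "c = (INF u \<in> H1. ereal (energy q u (\<lambda>_. 0)))"
    and "d = (INF u \<in> {u \<in> H1_sin. (u \<longlongrightarrow> 0) at_bot \<and> (u \<longlongrightarrow> 2 * pi) at_top}.
                ereal (energy q u (\<lambda>_. 0)))"
  shows "(- 2 \<le> q \<longrightarrow> (\<lambda>_. 0) \<in> H1 \<and> c = ereal (energy q (\<lambda>_. 0) (\<lambda>_. 0))) \<and>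
    (q < - 2 \<longrightarrow> pinned_state q \<in> H1 \<and> 0 > c \<and> c = ereal (energy q (pinned_state q) (\<lambda>_. 0))) \<and>
    (kink \<in> H1_sin \<and> (kink \<longlongrightarrow> 0) at_bot \<and> (kink \<longlongrightarrow> 2 * pi) at_top \<and>
      d = ereal (energy q kink (\<lambda>_. 0)))"
proof (intro conjI impI)
  assume q: "- 2 \<le> q"
  show "(\<lambda>_. 0) \<in> H1" by (rule zero_energy)
  have "0 \<le> energy q u (\<lambda>_. 0)" if "u \<in> H1" for u
  proof -
    obtain z where z: "\<bar>z\<bar> \<le> 1" "2 * (1 - z) * (4 + q * (1 + z)) \<le> energy q u (\<lambda>_. 0)"
      using energy_H1_ge_cos[OF \<open>u \<in> H1\<close>] by blast
    \<comment> \<open>Since \<open>1 + z\<close> is at most 2, this makes the second factor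
      nonnegative.\<close>
    have "(- 2) * (1 + z) \<le> q * (1 + z)" using q z(1) by (intro mult_right_mono) auto
    then have "0 \<le> 4 + q * (1 + z)" using z(1) by (simp add: abs_le_iff)
    then have "0 \<le> 2 * (1 - z) * (4 + q * (1 + z))" using z(1) by (intro mult_nonneg_nonneg) auto
    then show ?thesis using z(2) by linarith
  qed
  then show "c = ereal (energy q (\<lambda>_. 0) (\<lambda>_. 0))"
    unfolding assms(2) by (intro antisym INF_lower INF_greatest zero_energy) (simp add: zero_energy)
next
  assume q: "q < - 2"
  show "pinned_state q \<in> H1" by (rule pinned_state_energy[OF q])
  have "8 + 2 * q + 8 / q \<le> energy q u (\<lambda>_. 0)" if "u \<in> H1" for u
  proof -
    obtain z where z: "\<bar>z\<bar> \<le> 1" "2 * (1 - z) * (4 + q * (1 + z)) \<le> energy q u (\<lambda>_. 0)"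
      using energy_H1_ge_cos[OF \<open>u \<in> H1\<close>] by blast
    \<comment> \<open>Completing the square at the vertex \<open>z = -2 / q\<close>; the leading
      coefficient \<open>-2 q\<close> is positive.\<close>
    have "2 * (1 - z) * (4 + q * (1 + z)) = 8 + 2 * q + 8 / q - 2 * q * (z + 2 / q)\<^sup>2"
      using q by (simp add: field_simps power2_eq_square)
    moreover have "2 * q * (z + 2 / q)\<^sup>2 \<le> 0" using q by (simp add: mult_nonpos_nonneg)
    ultimately show ?thesis using z(2) by linarith
  qed
  then show c: "c = ereal (energy q (pinned_state q) (\<lambda>_. 0))"
    unfolding assms(2)
    by (intro antisym INF_lower INF_greatest pinned_state_energy q) (simp add: pinned_state_energy q)
  \<comment> \<open>Written as a square over \<open>q\<close>, the energy is strictly negative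
    because \<open>q\<close> differs from \<open>-2\<close>.\<close>
  have "8 + 2 * q + 8 / q = 2 * (q + 2)\<^sup>2 / q" using q by (simp add: field_simps power2_eq_square)
  also have "\<dots> < 0" using q by (intro divide_pos_neg) (auto simp: add_eq_0_iff)
  finally show "0 > c" by (simp add: c pinned_state_energy q)
next
  show "kink \<in> H1_sin" "(kink \<longlongrightarrow> 0) at_bot" "(kink \<longlongrightarrow> 2 * pi) at_top"
    by (rule kink_energy kink_limits)+
  then show "d = ereal (energy q kink (\<lambda>_. 0))"
    unfolding assms(3) using energy_ge_kink assms(1)
    by (intro antisym INF_lower INF_greatest) (auto simp: kink_energy)
qed

end
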